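(* Let $(X,\|\cdot\|)$ be a real reflexive Banach space, $n\ge2$, and let $\Omega_1,\ldots,\Omega_n\subset X$ be nonempty closed convex sets, at least one of which is bounded. Let $\psi\in\pmb{\Psi}_n$, let $\|\cdot\|_\psi$ be the associated norm on $\mathbb{R}^n$, and let $\mathrm{Sol}$ be the set of all global minimisers over $X$ of $$f(x):=\|(d(x,\Omega_1),\ldots,d(x,\Omega_n))\|_\psi,\quad x\in X.$$ Then the following assertions hold: (i) $\mathrm{Sol}$ is nonempty, closed, convex and bounded; (ii) if $\dim X<\infty$, then $\mathrm{Sol}$ is compact.
   Context: $d(x,\Omega):=\inf_{u\in\Omega}\|x-u\|$. For $n\ge2$ let $\Delta_n:=\{(t_1,\ldots,t_n)\in\mathbb{R}^n\mid t_i\ge0,\ \sum_{i=1}^nt_i=1\}$. $\pmb{\Psi}_n$ denotes the family of all convex continuous functions $\psi:\Delta_n\to\mathbb{R}$ such that $\psi(\mathbf{e}_1)=\cdots=\psi(\mathbf{e}_n)=1$ (where $\mathbf{e}_1,\ldots,\mathbf{e}_n$ is the standard basis of $\mathbb{R}^n$) and, for each $i=1,\ldots,n$, $$\psi(t_1,\ldots,t_n)\ge(1-t_i)\,\psi\left(\frac{t_1}{1-t_i},\ldots,\frac{t_{i-1}}{1-t_i},0,\frac{t_{i+1}}{1-t_i},\ldots,\frac{t_n}{1-t_i}\right)$$ for all $(t_1,\ldots,t_n)\in\Delta_n$ with $t_i<1$. For $\psi\in\pmb{\Psi}_n$, the function $\|x\|_\psi:=\left(\sum_{i=1}^n|x_i|\right)\psi\left(\frac{|x_1|}{\sum_{i}|x_i|},\ldots,\frac{|x_n|}{\sum_{i}|x_i|}\right)$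 for $x=(x_1,\ldots,x_n)\ne0$, with $\|0\|_\psi:=0$, is a norm on $\mathbb{R}^n$ (known fact). *)

theory Defs
  imports "HOL-Analysis.Analysis"
begin

definition bidual_embedding :: "'a::real_normed_vector \<Rightarrow> (('a \<Rightarrow>\<^sub>L real) \<Rightarrow>\<^sub>L real)" where
  "bidual_embedding x = Blinfun (\<lambda>f. blinfun_apply f x)"

lemma bidual_embedding_apply: "blinfun_apply (bidual_embedding x) f = blinfun_apply f x"
  unfolding bidual_embedding_def
  by (rule fun_cong[OF bounded_linear_Blinfun_apply[OF blinfun.bounded_linear_left]])

definition reflexive_space :: "'a::real_normed_vector itself \<Rightarrow> bool" where
  "reflexive_space _ \<longleftrightarrow> surj (bidual_embedding :: 'a \<Rightarrow> ('a \<Rightarrow>\<^sub>L real) \<Rightarrow>\<^sub>L real)"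

definition std_simplex :: "(real ^ 'n::finite) set" where
  "std_simplex = {t. (\<forall>i. 0 \<le> t $ i) \<and> (\<Sum>i\<in>UNIV. t $ i) = 1}"

text \<open>
  A function on the simplex is represented by a function on the whole of \<open>real ^ 'n\<close>, whose values
  off the simplex are unconstrained and are never used below.
\<close>

definition Psi_family :: "(real ^ 'n::finite \<Rightarrow> real) set" where
  "Psi_family = {\<psi>. convex_on std_simplex \<psi> \<and> continuous_on std_simplex \<psi> \<and>
     (\<forall>i. \<psi> (axis i 1) = 1) \<and>
     (\<forall>i. \<forall>t\<in>std_simplex. t $ i < 1 \<longrightarrow>
        \<psi> t \<ge> (1 - t $ i) * \<psi> (\<chi> j. if j = i then 0 else t $ j / (1 - t $ i)))}"

definition psi_norm :: "(real ^ 'n::finite \<Rightarrow> real) \<Rightarrow> real ^ 'n \<Rightarrow> real" where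
  "psi_norm \<psi> x = (if x = 0 then 0 else
     (\<Sum>i\<in>UNIV. \<bar>x $ i\<bar>) * \<psi> (\<chi> j. \<bar>x $ j\<bar> / (\<Sum>i\<in>UNIV. \<bar>x $ i\<bar>)))"

definition dist_objective ::
  "(real ^ 'n::finite \<Rightarrow> real) \<Rightarrow> ('n \<Rightarrow> 'a::metric_space set) \<Rightarrow> 'a \<Rightarrow> real" where
  "dist_objective \<psi> \<Omega> x = psi_norm \<psi> (\<chi> i. infdist x (\<Omega> i))"

definition Sol ::
  "(real ^ 'n::finite \<Rightarrow> real) \<Rightarrow> ('n \<Rightarrow> 'a::metric_space set) \<Rightarrow> 'a set" where
  "Sol \<psi> \<Omega> = {x. \<forall>y. dist_objective \<psi> \<Omega> x \<le> dist_objective \<psi> \<Omega> y}"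

end

theory Submission
  imports Defs
begin

text \<open>
  On the nonnegative orthant the \<psi>-norm is positively homogeneous, subadditive (convexity of \<psi>)
  and monotone (the defining inequality says that erasing a coordinate does not increase it, and
  convexity interpolates). Hence the objective \<open>f\<close> is convex, Lipschitz and, as it dominates the
  distance to the bounded set, coercive.

  For existence of a minimiser no weak topology is needed. Along a minimising sequence \<open>u\<close>, the
  functional \<open>g \<mapsto> limsup g (u k)\<close> on the dual is sublinear, so by Hahn-Banach it dominates a
  continuous linear functional, which by reflexivity is evaluation at some \<open>x\<close>. Applying
  \<open>g x \<le> limsup g (u k)\<close> to a subgradient \<open>g\<close> of \<open>f\<close> at \<open>x\<close> gives \<open>f x \<le> inf f\<close>.
  Hahn-Banach itself comes from Zorn's lemma: a minimal sublinear functional is linear.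
\<close>

section \<open>The Hahn-Banach theorem\<close>

definition sublinear :: "('a::real_vector \<Rightarrow> real) \<Rightarrow> bool" where
  "sublinear p \<longleftrightarrow> (\<forall>x y. p (x + y) \<le> p x + p y) \<and> (\<forall>c x. 0 \<le> c \<longrightarrow> p (c *\<^sub>R x) = c * p x)"

text \<open>Applying \<open>scale\<close> to \<open>inverse c\<close> gives the reverse inequality,
  and subadditivity at 0 forces \<open>p 0 = 0\<close>, which settles \<open>c = 0\<close>.\<close>

lemma sublinearI:
  assumes add: "\<And>x y. p (x + y) \<le> p x + p y"
    and scale: "\<And>c x. 0 < c \<Longrightarrow> p (c *\<^sub>R x) \<le> c * p x"
    and zero: "p 0 \<le> 0"
  shows "sublinear p"
  unfolding sublinear_def
proof (intro conjI allI impI add)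
  fix c :: real and x
  assume "0 \<le> c"
  have p0: "p 0 = 0"
    using add[of 0 0] zero by simp
  show "p (c *\<^sub>R x) = c * p x"
  proof (cases "c = 0")
    case False
    with \<open>0 \<le> c\<close> have c: "0 < c" by simp
    have "p x \<le> inverse c * p (c *\<^sub>R x)"
      using scale[of "inverse c" "c *\<^sub>R x"] c by simp
    then have "c * p x \<le> p (c *\<^sub>R x)"
      using c by (simp add: field_simps)
    with scale[OF c, of x] show ?thesis by simp
  qed (simp add: p0)
qed

lemma sublinear_add: "sublinear p \<Longrightarrow> p (x + y) \<le> p x + p y"
  and sublinear_scale: "sublinear p \<Longrightarrow> 0 \<le> c \<Longrightarrow> p (c *\<^sub>R x) = c * p x"
  by (simp_all add: sublinear_def)

lemma sublinear_zero: "sublinear p \<Longrightarrow> p 0 = 0"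
  using sublinear_scale[of p 0 0] by simp

lemma sublinear_minus: "sublinear p \<Longrightarrow> - p (- x) \<le> p x"
  using sublinear_add[of p x "- x"] sublinear_zero[of p] by simp

text \<open>Oddness makes subadditivity at \<open>- x\<close>, \<open>- y\<close> the reverse of
  subadditivity at \<open>x\<close>, \<open>y\<close>, and reduces negative scalars to positive
  ones.\<close>

lemma linear_if_sublinear_odd:
  assumes p: "sublinear p" and odd: "\<And>x. p (- x) \<le> - p x"
  shows "linear p"
proof -
  have minus: "p (- x) = - p x" for x
    using odd[of x] sublinear_minus[OF p, of x] by simp
  show ?thesis
  proof (rule linearI)
    show "p (x + y) = p x + p y" for x y
      using sublinear_add[OF p, of x y] sublinear_add[OF p, of "- x" "- y"]
        minus[of "x + y"] minus[of x] minus[of y] by simp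
    show "p (c *\<^sub>R x) = c *\<^sub>R p x" for c x
    proof (cases "0 \<le> c")
      case True
      then show ?thesis using sublinear_scale[OF p] by simp
    next
      case False
      then have "p ((- c) *\<^sub>R x) = (- c) * p x"
        by (intro sublinear_scale[OF p]) simp
      with minus[of "c *\<^sub>R x"] show ?thesis by simp
    qed
  qed
qed

text \<open>This supplies the chain bounds for Zorn's lemma. The infimum is finite because every
  member lies above \<open>- p (- x)\<close>.\<close>

lemma sublinear_Inf_chain:
  assumes C: "C \<noteq> {}" "\<And>q. q \<in> C \<Longrightarrow> sublinear q" "\<And>q. q \<in> C \<Longrightarrow> q \<le> p"
    and chain: "\<And>q r. q \<in> C \<Longrightarrow> r \<in> C \<Longrightarrow> q \<le> r \<or> r \<le> q"
  shows "sublinear (\<lambda>x. INF q\<in>C. q x)" and "\<And>q. q \<in> C \<Longrightarrow> (\<lambda>x. INF q\<in>C. q x) \<le> q"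
proof -
  have lb: "- p (- x) \<le> q x" if "q \<in> C" for q x
    using sublinear_minus[OF C(2)[OF that], of x] le_funD[OF C(3)[OF that], of "- x"] by linarith
  have bdd: "bdd_below ((\<lambda>q. q x) ` C)" for x
    using lb by (auto intro!: bdd_belowI2)
  have low: "(INF q\<in>C. q x) \<le> q x" if "q \<in> C" for q x
    using bdd that by (rule cINF_lower)
  then show "(\<lambda>x. INF q\<in>C. q x) \<le> q" if "q \<in> C" for q
    using that by (auto simp: le_fun_def)
  show "sublinear (\<lambda>x. INF q\<in>C. q x)"
  proof (rule sublinearI)
    fix x y
    \<comment> \<open>The infima at \<open>x\<close> and \<open>y\<close> are taken over independent
      members. Comparability lets the smaller of \<open>q\<close> and \<open>r\<close> serve at both
      points.\<close>
    have 1: "(INF q\<in>C. q (x + y)) \<le> q x + r y" if q: "q \<in> C" and r: "r \<in> C" for q r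
    proof (cases "q \<le> r")
      case True
      then show ?thesis
        using low[OF q, of "x + y"] sublinear_add[OF C(2)[OF q], of x y] le_funD[of q r y] by linarith
    next
      case False
      then have "r \<le> q" using chain[OF q r] by blast
      then show ?thesis
        using low[OF r, of "x + y"] sublinear_add[OF C(2)[OF r], of x y] le_funD[of r q x] by linarith
    qed
    have 2: "(INF q\<in>C. q (x + y)) - r y \<le> (INF q\<in>C. q x)" if r: "r \<in> C" for r
      using 1[OF _ r] by (intro cINF_greatest[OF C(1)]) (simp add: algebra_simps)
    have "(INF q\<in>C. q (x + y)) - (INF q\<in>C. q x) \<le> (INF q\<in>C. q y)"
      using 2 by (intro cINF_greatest[OF C(1)]) (simp add: algebra_simps)
    then show "(INF q\<in>C. q (x + y)) \<le> (INF q\<in>C. q x) + (INF q\<in>C. q y)"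
      by simp
  next
    fix c :: real and x
    assume c: "0 < c"
    have "(INF q\<in>C. q (c *\<^sub>R x)) / c \<le> (INF q\<in>C. q x)"
    proof (rule cINF_greatest[OF C(1)])
      fix q assume q: "q \<in> C"
      show "(INF q\<in>C. q (c *\<^sub>R x)) / c \<le> q x"
        using low[OF q, of "c *\<^sub>R x"] sublinear_scale[OF C(2)[OF q], of c x] c
        by (simp add: field_simps)
    qed
    then show "(INF q\<in>C. q (c *\<^sub>R x)) \<le> c * (INF q\<in>C. q x)"
      using c by (simp add: field_simps)
  next
    from C(1) obtain q where q: "q \<in> C" by blast
    then show "(INF q\<in>C. q 0) \<le> 0"
      using low[OF q, of 0] sublinear_zero[OF C(2)[OF q]] by simp
  qed
qed

text \<open>For fixed \<open>y\<close>, the functional \<open>r\<close> below is sublinear and, by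
  \<open>t = 0\<close>, lies under \<open>q\<close>; so it equals \<open>q\<close>. Taking
  \<open>t = 1\<close> at \<open>- y\<close> then gives \<open>q (- y) \<le> - q y\<close>.\<close>

lemma minimal_sublinear_linear:
  assumes q: "sublinear q" and min: "\<And>r. sublinear r \<Longrightarrow> r \<le> q \<Longrightarrow> r = q"
  shows "linear q"
proof (rule linear_if_sublinear_odd[OF q])
  fix y
  define r where "r x = (INF t\<in>{0..}. q (x + t *\<^sub>R y) - t * q y)" for x
  have lb: "- q (- x) \<le> q (x + t *\<^sub>R y) - t * q y" if "0 \<le> t" for t x
    using sublinear_add[OF q, of "x + t *\<^sub>R y" "- x"] sublinear_scale[OF q that, of y] by simp
  have low: "r x \<le> q (x + t *\<^sub>R y) - t * q y" if "0 \<le> t" for t x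
    unfolding r_def using lb that by (intro cINF_lower bdd_belowI2) auto
  have great: "m \<le> r x" if "\<And>t. 0 \<le> t \<Longrightarrow> m \<le> q (x + t *\<^sub>R y) - t * q y" for m x
    unfolding r_def using that by (intro cINF_greatest) auto
  have "sublinear r"
  proof (rule sublinearI)
    fix x z
    \<comment> \<open>The parameters add up: \<open>s + t\<close> is admissible for
      \<open>x + z\<close>. The infima over \<open>s\<close> and then over \<open>t\<close> are
      taken one after the other.\<close>
    have 1: "r (x + z) \<le> (q (x + s *\<^sub>R y) - s * q y) + (q (z + t *\<^sub>R y) - t * q y)"
      if "0 \<le> s" "0 \<le> t" for s t
      using low[of "s + t" "x + z"] that sublinear_add[OF q, of "x + s *\<^sub>R y" "z + t *\<^sub>R y"]
      by (simp add: algebra_simps)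
    have 2: "r (x + z) - (q (z + t *\<^sub>R y) - t * q y) \<le> r x" if "0 \<le> t" for t
      using 1[OF _ that] by (intro great) (simp add: algebra_simps)
    have "r (x + z) - r x \<le> r z"
      using 2 by (intro great) (simp add: algebra_simps)
    then show "r (x + z) \<le> r x + r z" by simp
  next
    fix c :: real and x
    assume c: "0 < c"
    have "r (c *\<^sub>R x) / c \<le> r x"
    proof (rule great)
      fix t :: real assume "0 \<le> t"
      then have "r (c *\<^sub>R x) \<le> q (c *\<^sub>R x + (c * t) *\<^sub>R y) - c * t * q y"
        using c by (intro low) simp
      also have "q (c *\<^sub>R x + (c * t) *\<^sub>R y) = c * q (x + t *\<^sub>R y)"
        using c sublinear_scale[OF q, of c "x + t *\<^sub>R y"] by (simp add: scaleR_add_right)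
      finally show "r (c *\<^sub>R x) / c \<le> q (x + t *\<^sub>R y) - t * q y"
        using c by (simp add: field_simps)
    qed
    then show "r (c *\<^sub>R x) \<le> c * r x"
      using c by (simp add: field_simps)
  next
    show "r 0 \<le> 0"
      using low[of 0 0] sublinear_zero[OF q] by simp
  qed
  moreover have "r \<le> q"
    using low[of 0] by (simp add: le_fun_def)
  ultimately have "r = q" by (rule min)
  with low[of 1 "- y"] sublinear_zero[OF q] show "q (- y) \<le> - q y" by simp
qed

theorem Hahn_Banach_sublinear:
  assumes p: "sublinear p"
  obtains g where "linear g" "\<And>x. g x \<le> p x"
proof -
  define A where "A = {q. sublinear q \<and> q \<le> p}"
  have "\<exists>m\<in>A. \<forall>a\<in>A. a \<le> m \<longrightarrow> a = m"
  \<comment> \<open>The order is reversed, so that maximal elements are minimal functionals and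
    bounds of chains are pointwise infima.\<close>
  proof (rule predicate_Zorn[where P = "\<lambda>q r. r \<le> q"])
    show "partial_order_on A (relation_of (\<lambda>q r. r \<le> q) A)"
      by (rule partial_order_on_relation_ofI) auto
    fix C assume C: "C \<in> Chains (relation_of (\<lambda>q r. r \<le> q) A)"
    show "\<exists>u\<in>A. \<forall>a\<in>C. u \<le> a"
    proof (cases "C = {}")
      case True
      then show ?thesis using p by (auto simp: A_def)
    next
      case False
      have *: "\<And>q. q \<in> C \<Longrightarrow> sublinear q" "\<And>q. q \<in> C \<Longrightarrow> q \<le> p"
        "\<And>q r. q \<in> C \<Longrightarrow> r \<in> C \<Longrightarrow> q \<le> r \<or> r \<le> q"
        using C by (auto simp: Chains_def relation_of_def A_def)
      from False obtain q where "q \<in> C" by blast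
      with sublinear_Inf_chain[OF False *] *(2)[of q]
      show ?thesis unfolding A_def by (intro bexI[of _ "\<lambda>x. INF q\<in>C. q x"]) (auto intro: order_trans)
    qed
  qed
  then obtain q where "q \<in> A" and min: "\<And>r. r \<in> A \<Longrightarrow> r \<le> q \<Longrightarrow> r = q"
    by blast
  then have "linear q"
    by (intro minimal_sublinear_linear) (auto simp: A_def intro: order_trans)
  with \<open>q \<in> A\<close> that show ?thesis
    by (auto simp: A_def le_fun_def)
qed

text \<open>Since a linear \<open>g\<close> is odd, the upper bound at \<open>x\<close> and at
  \<open>- x\<close> bounds \<open>\<bar>g x\<bar>\<close>, which gives continuity.\<close>

corollary Hahn_Banach_bounded:
  fixes p :: "'a::real_normed_vector \<Rightarrow> real"
  assumes p: "sublinear p" and bound: "\<And>x. p x \<le> K * norm x"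
  obtains g :: "'a \<Rightarrow>\<^sub>L real" where "\<And>x. blinfun_apply g x \<le> p x"
proof -
  from p obtain g where g: "linear g" "\<And>x. g x \<le> p x"
    by (rule Hahn_Banach_sublinear) blast
  have "\<bar>g x\<bar> \<le> K * norm x" for x
    using g(2)[of x] g(2)[of "- x"] bound[of x] bound[of "- x"] linear_neg[OF g(1), of x] by auto
  then have "bounded_linear g"
    using g(1) by (intro linear_conv_bounded_linear[THEN iffD1] bounded_linear_intro[of g K])
      (auto simp: linear_add linear_scale mult.commute)
  with g(2) that[of "Blinfun g"] show ?thesis
    by (simp add: bounded_linear_Blinfun_apply)
qed

section \<open>Minimisation of convex functions on reflexive spaces\<close>

text \<open>A linear functional below the directional derivative at \<open>x\<close> is a
  subgradient, as the difference quotient with step 1 shows.\<close>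

lemma convex_lipschitz_subgradient:
  fixes f :: "'a::real_normed_vector \<Rightarrow> real"
  assumes conv: "convex_on UNIV f" and lip: "\<And>x y. \<bar>f x - f y\<bar> \<le> L * norm (x - y)"
  obtains g :: "'a \<Rightarrow>\<^sub>L real" where "\<And>y. f x + g (y - x) \<le> f y"
proof -
  \<comment> \<open>For convex \<open>f\<close> the quotients are nondecreasing in \<open>t\<close>,
    so this infimum is the one-sided directional derivative. The Lipschitz bound keeps it
    finite.\<close>
  define p where "p h = (INF t\<in>{0<..}. (f (x + t *\<^sub>R h) - f x) / t)" for h
  have lb: "- (L * norm h) \<le> (f (x + t *\<^sub>R h) - f x) / t" if "0 < t" for t h
    using lip[of "x + t *\<^sub>R h" x] that by (simp add: field_simps abs_le_iff)
  have low: "p h \<le> (f (x + t *\<^sub>R h) - f x) / t" if "0 < t" for t h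
    unfolding p_def using lb that by (intro cINF_lower bdd_belowI2) auto
  have great: "m \<le> p h" if "\<And>t. 0 < t \<Longrightarrow> m \<le> (f (x + t *\<^sub>R h) - f x) / t" for m h
    unfolding p_def using that by (intro cINF_greatest) auto
  have sub: "sublinear p"
  proof (rule sublinearI)
    fix h k
    have 1: "p (h + k) \<le> (f (x + s *\<^sub>R h) - f x) / s + (f (x + t *\<^sub>R k) - f x) / t"
      if s: "0 < s" and t: "0 < t" for s t
    proof -
      \<comment> \<open>The step \<open>r\<close> makes \<open>x + r (h + k)\<close> a convex combination of \<open>x + s h\<close> and \<open>x + t k\<close>.\<close>
      define r where "r = s * t / (s + t)"
      have r: "0 < r" "r / s + r / t = 1"
        using s t by (simp_all add: r_def divide_simps)
      have "x + r *\<^sub>R (h + k) = (r / s + r / t) *\<^sub>R x + r *\<^sub>R (h + k)"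
        by (simp add: r(2))
      also have "\<dots> = (r / s) *\<^sub>R (x + s *\<^sub>R h) + (r / t) *\<^sub>R (x + t *\<^sub>R k)"
        using s t by (simp add: algebra_simps)
      finally have "f (x + r *\<^sub>R (h + k)) \<le> (r / s) * f (x + s *\<^sub>R h) + (r / t) * f (x + t *\<^sub>R k)"
        using conv r s t unfolding convex_on_def by (simp del: times_divide_eq_left)
      moreover have "f x = (r / s) * f x + (r / t) * f x"
        using r(2) by (simp flip: distrib_right del: times_divide_eq_left)
      ultimately have "f (x + r *\<^sub>R (h + k)) - f x
          \<le> (r / s) * (f (x + s *\<^sub>R h) - f x) + (r / t) * (f (x + t *\<^sub>R k) - f x)"
        by (simp add: algebra_simps)
      then have "(f (x + r *\<^sub>R (h + k)) - f x) / r
          \<le> (f (x + s *\<^sub>R h) - f x) / s + (f (x + t *\<^sub>R k) - f x) / t"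
        using r(1) by (simp add: pos_divide_le_eq distrib_right mult.commute[of _ r] distrib_left)
      with low[OF r(1), of "h + k"] show ?thesis by linarith
    qed
    have 2: "p (h + k) - (f (x + t *\<^sub>R k) - f x) / t \<le> p h" if "0 < t" for t
      using 1[OF _ that] by (intro great) (simp add: algebra_simps)
    have "p (h + k) - p h \<le> p k"
      using 2 by (intro great) (simp add: algebra_simps)
    then show "p (h + k) \<le> p h + p k" by simp
  next
    fix c :: real and h
    assume c: "0 < c"
    have "p (c *\<^sub>R h) / c \<le> p h"
    proof (rule great)
      fix t :: real assume t: "0 < t"
      show "p (c *\<^sub>R h) / c \<le> (f (x + t *\<^sub>R h) - f x) / t"
        \<comment> \<open>The quotient in direction \<open>c *\<^sub>R h\<close> with step
          \<open>t / c\<close> is \<open>c\<close> times the one in direction \<open>h\<close> with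
          step \<open>t\<close>.\<close>
        using low[of "t / c" "c *\<^sub>R h"] c t by (simp add: field_simps)
    qed
    then show "p (c *\<^sub>R h) \<le> c * p h"
      using c by (simp add: field_simps)
  next
    show "p 0 \<le> 0"
      using low[of 1 0] by simp
  qed
  have "p h \<le> L * norm h" for h
    using low[of 1 h] lip[of "x + h" x] by simp
  with sub obtain g :: "'a \<Rightarrow>\<^sub>L real" where g: "\<And>h. g h \<le> p h"
    by (rule Hahn_Banach_bounded) blast
  have "f x + g (y - x) \<le> f y" for y
    using g[of "y - x"] low[of 1 "y - x"] by simp
  then show ?thesis by (rule that)
qed

text \<open>Coercivity in this linear form serves twice: it bounds \<open>f\<close> below by
  \<open>- R\<close> and makes minimising sequences bounded.\<close>

theorem reflexive_convex_attains_min: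
  fixes f :: "'a::real_normed_vector \<Rightarrow> real"
  assumes refl: "reflexive_space TYPE('a)"
    and conv: "convex_on UNIV f" and lip: "\<And>x y. \<bar>f x - f y\<bar> \<le> L * norm (x - y)"
    and coercive: "\<And>x. norm x \<le> f x + R"
  obtains x where "\<And>y. f x \<le> f y"
proof -
  define m where "m = (INF x. f x)"
  have bdd: "bdd_below (range f)"
    using coercive by (intro bdd_belowI2[of _ "- R"]) (smt (verit) norm_ge_zero)
  have m: "m \<le> f x" for x
    unfolding m_def using bdd by (intro cINF_lower) auto
  have "\<exists>x. f x < m + inverse (real (Suc k))" for k
    using cINF_less_iff[OF _ bdd, of "m + inverse (real (Suc k))"] by (auto simp: m_def)
  then obtain u where u: "\<And>k. f (u k) < m + inverse (real (Suc k))"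
    by metis
  define K where "K = m + 1 + R"
  have K: "norm (u k) \<le> K" for k
  proof -
    have "inverse (real (Suc k)) \<le> 1" by (simp add: field_simps)
    with u[of k] coercive[of "u k"] show ?thesis by (simp add: K_def)
  qed
  have bnd: "\<bar>blinfun_apply g (u k)\<bar> \<le> K * norm g" for g :: "'a \<Rightarrow>\<^sub>L real" and k
    using norm_blinfun[of g "u k"] mult_left_mono[OF K[of k], of "norm g"] by (simp add: mult.commute)
  \<comment> \<open>The upper limit of \<open>g (u k)\<close>; the filter form makes sublinearity immediate.\<close>
  define B where "B g = {c. eventually (\<lambda>k. blinfun_apply g (u k) \<le> c) sequentially}"
    for g :: "'a \<Rightarrow>\<^sub>L real"
  define P where "P g = Inf (B g)" for g
  have ub: "K * norm g \<in> B g" for g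
    using bnd[of g] by (auto simp: B_def abs_le_iff)
  have lb: "- (K * norm g) \<le> c" if "c \<in> B g" for c g
  proof -
    from that obtain k where "g (u k) \<le> c"
      by (auto simp: B_def eventually_sequentially)
    with bnd[of g k] show ?thesis by simp
  qed
  have low: "P g \<le> c" if "c \<in> B g" for c g
    unfolding P_def using that lb by (intro cInf_lower bdd_belowI[of _ "- (K * norm g)"]) auto
  have great: "l \<le> P g" if "\<And>c. c \<in> B g \<Longrightarrow> l \<le> c" for l g
    unfolding P_def using that ub[of g] by (intro cInf_greatest) auto
  have "sublinear P"
  proof (rule sublinearI)
    fix g h :: "'a \<Rightarrow>\<^sub>L real"
    have 1: "P (g + h) \<le> c + d" if "c \<in> B g" "d \<in> B h" for c d
    proof (rule low)
      show "c + d \<in> B (g + h)"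
        using that unfolding B_def mem_Collect_eq
        by (rule eventually_elim2) (simp add: blinfun.add_left add_mono)
    qed
    have 2: "P (g + h) - d \<le> P g" if "d \<in> B h" for d
      using 1[OF _ that] by (intro great) (simp add: algebra_simps)
    have "P (g + h) - P g \<le> P h"
      using 2 by (intro great) (simp add: algebra_simps)
    then show "P (g + h) \<le> P g + P h" by simp
  next
    fix c :: real and g :: "'a \<Rightarrow>\<^sub>L real"
    assume c: "0 < c"
    have "P (c *\<^sub>R g) / c \<le> P g"
    proof (rule great)
      fix d assume "d \<in> B g"
      then have "c * d \<in> B (c *\<^sub>R g)"
        unfolding B_def mem_Collect_eq using c
        by (auto elim!: eventually_mono simp: blinfun.scaleR_left)
      from low[OF this] show "P (c *\<^sub>R g) / c \<le> d"
        using c by (simp add: field_simps)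
    qed
    then show "P (c *\<^sub>R g) \<le> c * P g"
      using c by (simp add: field_simps)
  next
    show "P 0 \<le> 0" using low[OF ub[of 0]] by simp
  qed
  moreover have "P g \<le> K * norm g" for g :: "'a \<Rightarrow>\<^sub>L real"
    by (rule low[OF ub])
  ultimately obtain F :: "('a \<Rightarrow>\<^sub>L real) \<Rightarrow>\<^sub>L real" where F: "\<And>g. F g \<le> P g"
    by (rule Hahn_Banach_bounded) blast
  \<comment> \<open>This replaces the extraction of a weak limit: \<open>x\<close> is only known to
    satisfy \<open>g x \<le> P g\<close> for every \<open>g\<close>, which suffices.\<close>
  from refl obtain x where x: "bidual_embedding x = F"
    unfolding reflexive_space_def by (metis surjD)
  have gx: "g x \<le> P g" for g :: "'a \<Rightarrow>\<^sub>L real"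
    using F[of g] unfolding x[symmetric] by (simp add: bidual_embedding_apply)
  obtain g :: "'a \<Rightarrow>\<^sub>L real" where g: "\<And>y. f x + g (y - x) \<le> f y"
    using convex_lipschitz_subgradient[OF conv lip] by blast
  have "f x \<le> m"
  proof (rule field_le_epsilon)
    fix e :: real assume e: "0 < e"
    have "eventually (\<lambda>k. inverse (real (Suc k)) < e) sequentially"
      using LIMSEQ_inverse_real_of_nat e by (rule order_tendstoD)
    \<comment> \<open>The subgradient inequality at \<open>u k\<close> reads
      \<open>g (u k) \<le> f (u k) - f x + g x\<close>, and \<open>f (u k)\<close> is eventually
      below \<open>m + e\<close>. Comparison with \<open>g x \<le> P g\<close> cancels
      \<open>g x\<close>.\<close>
    then have "eventually (\<lambda>k. g (u k) \<le> m + e - f x + g x) sequentially"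
    proof eventually_elim
      case (elim k)
      with u[of k] g[of "u k"] show ?case by (simp add: blinfun.diff_right)
    qed
    then have "P g \<le> m + e - f x + g x"
      by (intro low) (simp add: B_def)
    with gx[of g] show "f x \<le> m + e" by simp
  qed
  with m that show ?thesis by (meson order_trans)
qed

section \<open>Compactness in finite-dimensional spaces\<close>

text \<open>A convergent sequence is bounded, so it lies in a single ball, whose intersection with
  \<open>S\<close> is closed and hence contains the limit.\<close>

lemma closed_if_compact_Int_cball:
  fixes S :: "'a::real_normed_vector set"
  assumes "\<And>r. compact (S \<inter> cball 0 r)"
  shows "closed S"
proof -
  have "l \<in> S" if s: "\<And>n. s n \<in> S" and l: "s \<longlonglongrightarrow> l" for s l
  proof -
    have "bounded (range s)"
      using l by (rule convergent_imp_bounded)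
    then obtain r where "\<And>n. norm (s n) \<le> r"
      by (auto simp: bounded_iff)
    then have "\<And>n. s n \<in> S \<inter> cball 0 r"
      using s by simp
    moreover have "closed (S \<inter> cball 0 r)"
      using assms by (rule compact_imp_closed)
    ultimately have "l \<in> S \<inter> cball 0 r"
      using l by (meson closed_sequentially)
    then show ?thesis by simp
  qed
  then show ?thesis by (meson closed_sequential_limits)
qed

text \<open>Heine-Borel by induction on the spanning set. A new vector \<open>a\<close> has positive
  distance from the closed subspace \<open>span B\<close>, which controls its coefficient. The
  radius is arbitrary because the step needs the hypothesis for other radii.\<close>

lemma compact_span_Int_cball:
  fixes B :: "'a::real_normed_vector set"
  assumes "finite B"
  shows "compact (span B \<inter> cball 0 r)"
  using assms
proof (induction B arbitrary: r rule: finite_induct)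
  case empty
  show ?case by (rule finite_imp_compact) (simp add: finite_subset[of _ "{0}"])
next
  case (insert a B)
  show ?case
  proof (cases "a \<in> span B")
    case True
    then show ?thesis using insert.IH by (simp add: span_redundant)
  next
    case False
    define d where "d = infdist a (span B)"
    have "closed (span B)"
      using insert.IH by (rule closed_if_compact_Int_cball)
    then have d: "0 < d"
      unfolding d_def using False span_zero by (intro infdist_pos_not_in_closed) auto
    \<comment> \<open>Factor out \<open>c\<close>: the vector \<open>- inverse c *\<^sub>R y\<close>
      again lies in \<open>span B\<close>, so its distance from \<open>a\<close> is at least
      \<open>d\<close>.\<close>
    have dist: "\<bar>c\<bar> * d \<le> norm (c *\<^sub>R a + y)" if "y \<in> span B" for c y
    proof (cases "c = 0")
      case False
      have "d \<le> dist a (- inverse c *\<^sub>R y)"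
        unfolding d_def using that by (intro infdist_le span_scale)
      then have "\<bar>c\<bar> * d \<le> \<bar>c\<bar> * norm (a + inverse c *\<^sub>R y)"
        by (intro mult_left_mono) (simp_all add: dist_norm)
      also have "\<dots> = norm (c *\<^sub>R (a + inverse c *\<^sub>R y))" by simp
      also have "c *\<^sub>R (a + inverse c *\<^sub>R y) = c *\<^sub>R a + y"
        using False by (simp add: scaleR_add_right)
      finally show ?thesis .
    qed simp
    \<comment> \<open>If \<open>norm (c *\<^sub>R a + y) \<le> r\<close>, then \<open>M\<close>
      bounds the coefficient \<open>c\<close> and \<open>N\<close> bounds \<open>norm y\<close>.
      Thus \<open>K\<close> is a compact set containing the whole slice, though possibly leaving the
      ball.\<close>
    define M where "M = r / d"
    define N where "N = r + M * norm a"
    define K where "K = (\<lambda>(c, y). c *\<^sub>R a + y) ` ({- M..M} \<times> (span B \<inter> cball 0 N))"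
    have "compact K"
      unfolding K_def
      by (intro compact_continuous_image compact_Times insert.IH compact_Icc)
        (auto simp: split_beta intro!: continuous_intros)
    moreover have "span (insert a B) \<inter> cball 0 r = K \<inter> cball 0 r"
    proof (intro equalityI subsetI)
      fix x assume x: "x \<in> span (insert a B) \<inter> cball 0 r"
      then obtain c where c: "x - c *\<^sub>R a \<in> span B"
        by (auto simp: span_insert)
      have "\<bar>c\<bar> * d \<le> r"
        using dist[OF c, of c] x by simp
      then have cM: "\<bar>c\<bar> \<le> M"
        using d by (simp add: M_def field_simps)
      have "norm (x - c *\<^sub>R a) \<le> norm x + \<bar>c\<bar> * norm a"
        using norm_triangle_ineq4[of x "c *\<^sub>R a"] by simp
      also have "\<dots> \<le> N"
        using x cM unfolding N_def by (intro add_mono mult_right_mono) auto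
      finally have "(c, x - c *\<^sub>R a) \<in> {- M..M} \<times> (span B \<inter> cball 0 N)"
        using c cM by auto
      then have "x \<in> K"
        unfolding K_def by (rule rev_image_eqI) simp
      with x show "x \<in> K \<inter> cball 0 r" by simp
    next
      fix x assume "x \<in> K \<inter> cball 0 r"
      then show "x \<in> span (insert a B) \<inter> cball 0 r"
        by (auto simp: K_def intro!: span_add span_scale span_base[of a]
            elim: subsetD[OF span_mono[of B "insert a B"], rotated])
    qed
    ultimately show ?thesis by (simp add: compact_Int_closed)
  qed
qed

lemma compact_if_closed_bounded_finite_span:
  fixes B S :: "'a::real_normed_vector set"
  assumes B: "finite B" "span B = UNIV" and "closed S" and "bounded S"
  shows "compact S"
proof -
  from \<open>bounded S\<close> obtain r where "S \<subseteq> cball 0 r"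
    by (auto simp: bounded_iff subset_iff)
  moreover have "compact (cball (0::'a) r)"
    using compact_span_Int_cball[OF B(1), of r] B(2) by simp
  ultimately show ?thesis
    using \<open>closed S\<close> compact_Int_closed by (metis inf.absorb2)
qed

section \<open>The norm associated with \<psi>\<close>

text \<open>On the orthant the absolute values disappear, and the formula covers
  \<open>x = 0\<close> as well because the factor \<open>s\<close> vanishes there.\<close>

lemma psi_norm_nonneg_eq:
  assumes x: "\<And>i. 0 \<le> x $ i" and s: "s = (\<Sum>i\<in>UNIV. x $ i)"
  shows "psi_norm \<psi> x = s * \<psi> (inverse s *\<^sub>R x)"
proof (cases "x = 0")
  case False
  have "(\<chi> j. \<bar>x $ j\<bar> / (\<Sum>i\<in>UNIV. \<bar>x $ i\<bar>)) = inverse s *\<^sub>R x"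
    using x by (simp add: vec_eq_iff s field_simps)
  with False x show ?thesis by (simp add: psi_norm_def s)
qed (simp add: psi_norm_def s)

lemma sum_components_pos:
  fixes x :: "real ^ 'n"
  assumes "\<And>i. 0 \<le> x $ i" and "x \<noteq> 0"
  shows "0 < (\<Sum>i\<in>UNIV. x $ i)"
proof -
  from \<open>x \<noteq> 0\<close> obtain i where "x $ i \<noteq> 0" by (auto simp: vec_eq_iff)
  with assms(1)[of i] have "0 < x $ i" by simp
  then show ?thesis using assms(1) by (intro sum_pos2[of _ i]) auto
qed

lemma normalised_in_std_simplex:
  fixes x :: "real ^ 'n"
  assumes "\<And>i. 0 \<le> x $ i" and "x \<noteq> 0"
  shows "inverse (\<Sum>i\<in>UNIV. x $ i) *\<^sub>R x \<in> std_simplex"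
proof -
  have "0 < (\<Sum>i\<in>UNIV. x $ i)" using assms by (rule sum_components_pos)
  then show ?thesis
    using assms(1) by (simp add: std_simplex_def flip: sum_distrib_left)
qed

lemma psi_norm_scale:
  assumes "\<And>i. 0 \<le> x $ i" and c: "0 \<le> c"
  shows "psi_norm \<psi> (c *\<^sub>R x) = c * psi_norm \<psi> x"
proof (cases "c = 0")
  case False
  have "psi_norm \<psi> (c *\<^sub>R x) = (c * (\<Sum>i\<in>UNIV. x $ i)) *
      \<psi> (inverse (c * (\<Sum>i\<in>UNIV. x $ i)) *\<^sub>R c *\<^sub>R x)"
    using assms by (intro psi_norm_nonneg_eq) (simp_all add: sum_distrib_left)
  also have "inverse (c * (\<Sum>i\<in>UNIV. x $ i)) *\<^sub>R c *\<^sub>R x = inverse (\<Sum>i\<in>UNIV. x $ i) *\<^sub>R x"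
    using False by simp
  finally show ?thesis
    using psi_norm_nonneg_eq[OF assms(1) refl, of \<psi>] by simp
qed (simp add: psi_norm_def)

context
  fixes \<psi> :: "real ^ 'n::finite \<Rightarrow> real"
  assumes \<psi>: "\<psi> \<in> Psi_family"
begin

lemma psi_norm_axis:
  assumes "0 \<le> c"
  shows "psi_norm \<psi> (axis i c) = c"
proof -
  have "(\<Sum>j\<in>UNIV. axis i c $ j) = c"
    by (simp add: axis_def)
  then have "psi_norm \<psi> (axis i c) = c * \<psi> (inverse c *\<^sub>R axis i c)"
    using assms by (intro psi_norm_nonneg_eq) (simp_all add: axis_def)
  moreover have "c \<noteq> 0 \<Longrightarrow> inverse c *\<^sub>R axis i c = axis i 1"
    by (simp add: vec_eq_iff axis_def)
  ultimately show ?thesis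
    using \<psi> by (cases "c = 0") (auto simp: Psi_family_def)
qed

text \<open>The normalised sum is the convex combination of the normalised vectors with weights
  \<open>a / (a + b)\<close> and \<open>b / (a + b)\<close>, so convexity of \<open>\<psi>\<close>
  applies.\<close>

lemma psi_norm_add:
  assumes x: "\<And>i. 0 \<le> x $ i" and y: "\<And>i. 0 \<le> y $ i"
  shows "psi_norm \<psi> (x + y) \<le> psi_norm \<psi> x + psi_norm \<psi> y"
proof (cases "x = 0 \<or> y = 0")
  case False
  define a b where "a = (\<Sum>i\<in>UNIV. x $ i)" and "b = (\<Sum>i\<in>UNIV. y $ i)"
  have a: "0 < a" and b: "0 < b"
    using False sum_components_pos x y by (auto simp: a_def b_def)
  have ab: "a / (a + b) + b / (a + b) = 1"
    using a b by (simp flip: add_divide_distrib)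
  have "inverse (a + b) *\<^sub>R (x + y) =
      (a / (a + b)) *\<^sub>R (inverse a *\<^sub>R x) + (b / (a + b)) *\<^sub>R (inverse b *\<^sub>R y)"
    using a b by (simp add: scaleR_add_right field_simps)
  also have "\<psi> \<dots> \<le> (a / (a + b)) * \<psi> (inverse a *\<^sub>R x) + (b / (a + b)) * \<psi> (inverse b *\<^sub>R y)"
  proof -
    have "convex_on std_simplex \<psi>"
      using \<psi> by (simp add: Psi_family_def)
    moreover have "inverse a *\<^sub>R x \<in> std_simplex" "inverse b *\<^sub>R y \<in> std_simplex"
      using False x y normalised_in_std_simplex by (auto simp: a_def b_def)
    moreover have "0 \<le> a / (a + b)" "0 \<le> b / (a + b)"
      using a b by simp_all
    ultimately show ?thesis
      using ab unfolding convex_on_def by blast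
  qed
  finally have "(a + b) * \<psi> (inverse (a + b) *\<^sub>R (x + y)) \<le>
      a * \<psi> (inverse a *\<^sub>R x) + b * \<psi> (inverse b *\<^sub>R y)"
    using a b by (simp add: pos_le_divide_eq mult.commute[of "a + b"] flip: add_divide_distrib)
  moreover have "psi_norm \<psi> (x + y) = (a + b) * \<psi> (inverse (a + b) *\<^sub>R (x + y))"
    using x y by (intro psi_norm_nonneg_eq) (simp_all add: a_def b_def sum.distrib)
  ultimately show ?thesis
    using psi_norm_nonneg_eq[OF x a_def, of \<psi>] psi_norm_nonneg_eq[OF y b_def, of \<psi>] by simp
qed (auto simp: psi_norm_def)

text \<open>This is the defining inequality of \<open>Psi_family\<close> at the normalised vector
  \<open>t\<close>, multiplied by \<open>s\<close>; note that \<open>s - x $ i\<close> is the sum of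
  the erased vector.\<close>

lemma psi_norm_erase:
  assumes x: "\<And>i. 0 \<le> x $ i"
  shows "psi_norm \<psi> (\<chi> j. if j = i then 0 else x $ j) \<le> psi_norm \<psi> x" (is "psi_norm \<psi> ?z \<le> _")
proof (cases "?z = 0")
  \<comment> \<open>The defining inequality requires \<open>t $ i < 1\<close>, so vectors supported
    on coordinate \<open>i\<close> are treated apart.\<close>
  case True
  then have "x = axis i (x $ i)"
    by (simp add: vec_eq_iff axis_def) metis
  then have "psi_norm \<psi> x = x $ i"
    using psi_norm_axis[OF x[of i], of i] by simp
  with True x show ?thesis by (simp add: psi_norm_def)
next
  case False
  then have "x \<noteq> 0" by (auto simp: vec_eq_iff split: if_splits)
  define s where "s = (\<Sum>i\<in>UNIV. x $ i)"
  have s: "0 < s"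
    unfolding s_def using x \<open>x \<noteq> 0\<close> by (rule sum_components_pos)
  have z: "0 \<le> ?z $ j" for j using x by simp
  have sz: "s - x $ i = (\<Sum>j\<in>UNIV. ?z $ j)"
  proof -
    have "(\<Sum>j\<in>UNIV. ?z $ j) = (\<Sum>j\<in>UNIV - {i}. x $ j)"
      by (subst sum.remove[of _ i]) (auto intro: sum.cong)
    then show ?thesis
      unfolding s_def by (subst (1) sum.remove[of _ i]) auto
  qed
  have "0 < s - x $ i"
    unfolding sz using z False by (rule sum_components_pos)
  define t where "t = inverse s *\<^sub>R x"
  have "t \<in> std_simplex"
    unfolding t_def s_def using x \<open>x \<noteq> 0\<close> by (rule normalised_in_std_simplex)
  moreover have "t $ i < 1"
    using s \<open>0 < s - x $ i\<close> by (simp add: t_def field_simps)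
  ultimately have "(1 - t $ i) * \<psi> (\<chi> j. if j = i then 0 else t $ j / (1 - t $ i)) \<le> \<psi> t"
    using \<psi> by (auto simp: Psi_family_def)
  then have "s * ((1 - t $ i) * \<psi> (\<chi> j. if j = i then 0 else t $ j / (1 - t $ i))) \<le> s * \<psi> t"
    using s by (intro mult_left_mono) auto
  moreover have ti: "s * (1 - t $ i) = s - x $ i"
    using s by (simp add: t_def field_simps)
  moreover have "(\<chi> j. if j = i then 0 else t $ j / (1 - t $ i)) = inverse (s - x $ i) *\<^sub>R ?z"
    using s unfolding ti[symmetric] by (simp add: vec_eq_iff t_def divide_inverse)
  ultimately have "(s - x $ i) * \<psi> (inverse (s - x $ i) *\<^sub>R ?z) \<le> s * \<psi> t"
    by (simp add: mult.assoc[symmetric])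
  then show ?thesis
    using psi_norm_nonneg_eq[OF x s_def, of \<psi>] psi_norm_nonneg_eq[OF z sz, of \<psi>] by (simp add: t_def)
qed

text \<open>The lowered vector is a convex combination of \<open>z\<close> and its erasure
  \<open>w\<close>, with weight \<open>c / z $ i\<close> on \<open>z\<close>.\<close>

lemma psi_norm_decrease_component:
  assumes z: "\<And>i. 0 \<le> z $ i" and c: "0 \<le> c" "c \<le> z $ i"
  shows "psi_norm \<psi> (\<chi> j. if j = i then c else z $ j) \<le> psi_norm \<psi> z"
proof (cases "z $ i = 0")
  case True
  with c have "(\<chi> j. if j = i then c else z $ j) = z"
    by (simp add: vec_eq_iff)
  then show ?thesis by simp
next
  case False
  with z[of i] have zi: "0 < z $ i" by simp
  define u where "u = c / z $ i"
  define w where "w = (\<chi> j. if j = i then 0 else z $ j)"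
  have u: "0 \<le> u" "u \<le> 1"
    using c zi by (simp_all add: u_def)
  have w: "0 \<le> w $ j" for j
    using z by (simp add: w_def)
  have "(\<chi> j. if j = i then c else z $ j) = u *\<^sub>R z + (1 - u) *\<^sub>R w"
    using zi by (simp add: vec_eq_iff u_def w_def field_simps)
  also have "psi_norm \<psi> \<dots> \<le> u * psi_norm \<psi> z + (1 - u) * psi_norm \<psi> w"
    using psi_norm_add[of "u *\<^sub>R z" "(1 - u) *\<^sub>R w"] psi_norm_scale[of z u \<psi>]
      psi_norm_scale[of w "1 - u" \<psi>] u z w by simp
  also have "\<dots> \<le> u * psi_norm \<psi> z + (1 - u) * psi_norm \<psi> z"
    using psi_norm_erase[OF z, of i] u by (intro add_left_mono mult_left_mono) (simp_all add: w_def)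
  finally show ?thesis by (simp add: algebra_simps)
qed

text \<open>Coordinates are lowered one at a time; \<open>A\<close> collects those already lowered
  from \<open>y\<close> to \<open>x\<close>.\<close>

lemma psi_norm_mono:
  assumes x: "\<And>i. 0 \<le> x $ i" and xy: "\<And>i. x $ i \<le> y $ i"
  shows "psi_norm \<psi> x \<le> psi_norm \<psi> y"
proof -
  have y: "0 \<le> y $ i" for i using x[of i] xy[of i] by simp
  have "psi_norm \<psi> (\<chi> j. if j \<in> A then x $ j else y $ j) \<le> psi_norm \<psi> y" if "finite A" for A
    using that
  proof induction
    case (insert i A)
    let ?z = "\<chi> j. if j \<in> A then x $ j else y $ j"
    have "(\<chi> j. if j \<in> insert i A then x $ j else y $ j) = (\<chi> j. if j = i then x $ i else ?z $ j)"
      by (simp add: vec_eq_iff)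
    also have "psi_norm \<psi> \<dots> \<le> psi_norm \<psi> ?z"
      using x y xy by (intro psi_norm_decrease_component) simp_all
    finally show ?case using insert.IH by simp
  qed simp
  from this[of UNIV] show ?thesis by simp
qed

lemma component_le_psi_norm:
  assumes "\<And>i. 0 \<le> x $ i"
  shows "x $ i \<le> psi_norm \<psi> x"
proof -
  have "psi_norm \<psi> (axis i (x $ i)) \<le> psi_norm \<psi> x"
    using assms by (intro psi_norm_mono) (simp_all add: axis_def)
  then show ?thesis using psi_norm_axis[OF assms[of i], of i] by simp
qed

text \<open>Subadditivity over the decomposition into axis vectors, each of which has its
  coefficient as norm.\<close>

lemma psi_norm_le_sum:
  assumes x: "\<And>i. 0 \<le> x $ i"
  shows "psi_norm \<psi> x \<le> (\<Sum>i\<in>UNIV. x $ i)"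
proof -
  have "psi_norm \<psi> (\<Sum>i\<in>A. axis i (x $ i)) \<le> (\<Sum>i\<in>A. x $ i)" if "finite A" for A
    using that
  proof induction
    case (insert i A)
    have nonneg: "0 \<le> axis j (x $ j) $ k" for j k
      using x by (simp add: axis_def)
    have "psi_norm \<psi> (axis i (x $ i) + (\<Sum>j\<in>A. axis j (x $ j)))
        \<le> psi_norm \<psi> (axis i (x $ i)) + psi_norm \<psi> (\<Sum>j\<in>A. axis j (x $ j))"
      using nonneg by (intro psi_norm_add) (simp_all add: sum_nonneg)
    then show ?case
      using insert psi_norm_axis[OF x[of i], of i] by simp
  qed (simp add: psi_norm_def)
  moreover have "(\<Sum>i\<in>UNIV. axis i (x $ i)) = x"
    by (simp add: vec_eq_iff axis_def)
  ultimately show ?thesis by (metis finite_class.finite_UNIV)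
qed

lemma psi_norm_lipschitz:
  assumes x: "\<And>i. 0 \<le> x $ i" and y: "\<And>i. 0 \<le> y $ i"
  shows "\<bar>psi_norm \<psi> x - psi_norm \<psi> y\<bar> \<le> (\<Sum>i\<in>UNIV. \<bar>x $ i - y $ i\<bar>)"
proof -
  \<comment> \<open>Componentwise \<open>x\<close> lies below \<open>y + ?d\<close>, so monotonicity
    and subadditivity apply. The claim is stated for all \<open>x\<close> and \<open>y\<close> to
    allow swapping them.\<close>
  have "psi_norm \<psi> x \<le> psi_norm \<psi> y + (\<Sum>i\<in>UNIV. \<bar>x $ i - y $ i\<bar>)"
    if x: "\<And>i. 0 \<le> x $ i" and y: "\<And>i. 0 \<le> y $ i" for x y
  proof -
    let ?d = "\<chi> i. \<bar>x $ i - y $ i\<bar>"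
    have "psi_norm \<psi> x \<le> psi_norm \<psi> (y + ?d)"
      using x by (intro psi_norm_mono) (simp_all add: abs_if)
    also have "\<dots> \<le> psi_norm \<psi> y + psi_norm \<psi> ?d"
      using y by (intro psi_norm_add) simp_all
    also have "psi_norm \<psi> ?d \<le> (\<Sum>i\<in>UNIV. \<bar>x $ i - y $ i\<bar>)"
      using psi_norm_le_sum[of ?d] by simp
    finally show ?thesis by simp
  qed
  from this[OF x y] this[OF y x] show ?thesis
    by (simp add: abs_le_iff abs_minus_commute algebra_simps)
qed

end

section \<open>The distance objective\<close>

lemma convex_on_infdist:
  fixes S :: "'a::real_normed_vector set"
  assumes S: "convex S" "S \<noteq> {}"
  shows "convex_on UNIV (\<lambda>x. infdist x S)"
proof (rule convex_onI)
  fix t :: real and x y :: 'a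
  assume t: "0 < t" "t < 1"
  \<comment> \<open>The distance need not be attained, so points within \<open>e\<close> of it are
    used; the weights sum to 1, so the total error is again \<open>e\<close>.\<close>
  have near: "\<exists>a\<in>S. dist z a < infdist z S + e" if "0 < e" for z e
    using cINF_less_iff[of S "dist z" "infdist z S + e"] S(2) that by (auto simp: infdist_notempty)
  show "infdist ((1 - t) *\<^sub>R x + t *\<^sub>R y) S \<le> (1 - t) * infdist x S + t * infdist y S"
  proof (rule field_le_epsilon)
    fix e :: real assume "0 < e"
    with near obtain a b where a: "a \<in> S" "dist x a < infdist x S + e"
      and b: "b \<in> S" "dist y b < infdist y S + e" by meson
    have "infdist ((1 - t) *\<^sub>R x + t *\<^sub>R y) S
        \<le> dist ((1 - t) *\<^sub>R x + t *\<^sub>R y) ((1 - t) *\<^sub>R a + t *\<^sub>R b)"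
      using S(1) a b t by (intro infdist_le convexD) auto
    also have "\<dots> = norm ((1 - t) *\<^sub>R (x - a) + t *\<^sub>R (y - b))"
      by (simp add: dist_norm algebra_simps)
    also have "\<dots> \<le> (1 - t) * dist x a + t * dist y b"
      using norm_triangle_ineq[of "(1 - t) *\<^sub>R (x - a)" "t *\<^sub>R (y - b)"] t by (simp add: dist_norm)
    also have "\<dots> \<le> (1 - t) * (infdist x S + e) + t * (infdist y S + e)"
      using a b t by (intro add_mono mult_left_mono) auto
    finally show "infdist ((1 - t) *\<^sub>R x + t *\<^sub>R y) S \<le> (1 - t) * infdist x S + t * infdist y S + e"
      by (simp add: algebra_simps)
  qed
qed simp

text \<open>Convexity of each distance passes through the \<psi>-norm because the latter is monotone
  and sublinear on the orthant.\<close>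

lemma dist_objective_convex:
  fixes \<Omega> :: "'n::finite \<Rightarrow> 'a::real_normed_vector set"
  assumes \<psi>: "\<psi> \<in> Psi_family" and \<Omega>: "\<And>i. convex (\<Omega> i)" "\<And>i. \<Omega> i \<noteq> {}"
  shows "convex_on UNIV (dist_objective \<psi> \<Omega>)"
proof (rule convex_onI)
  fix t :: real and x y :: 'a
  assume t: "0 < t" "t < 1"
  let ?d = "\<lambda>x. \<chi> i. infdist x (\<Omega> i)"
  have "psi_norm \<psi> (?d ((1 - t) *\<^sub>R x + t *\<^sub>R y)) \<le> psi_norm \<psi> ((1 - t) *\<^sub>R ?d x + t *\<^sub>R ?d y)"
    using convex_onD[OF convex_on_infdist[OF \<Omega>], of t x y] t
    by (intro psi_norm_mono[OF \<psi>]) (simp_all add: infdist_nonneg)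
  also have "\<dots> \<le> psi_norm \<psi> ((1 - t) *\<^sub>R ?d x) + psi_norm \<psi> (t *\<^sub>R ?d y)"
    using t by (intro psi_norm_add[OF \<psi>]) (simp_all add: infdist_nonneg)
  also have "\<dots> = (1 - t) * psi_norm \<psi> (?d x) + t * psi_norm \<psi> (?d y)"
    using t by (simp add: psi_norm_scale infdist_nonneg)
  finally show "dist_objective \<psi> \<Omega> ((1 - t) *\<^sub>R x + t *\<^sub>R y)
      \<le> (1 - t) * dist_objective \<psi> \<Omega> x + t * dist_objective \<psi> \<Omega> y"
    by (simp add: dist_objective_def)
qed simp

lemma dist_objective_lipschitz:
  fixes \<Omega> :: "'n::finite \<Rightarrow> 'a::metric_space set"
  assumes \<psi>: "\<psi> \<in> Psi_family"
  shows "\<bar>dist_objective \<psi> \<Omega> x - dist_objective \<psi> \<Omega> y\<bar> \<le> real CARD('n) * dist x y"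
proof -
  have "\<bar>dist_objective \<psi> \<Omega> x - dist_objective \<psi> \<Omega> y\<bar>
      \<le> (\<Sum>i\<in>UNIV. \<bar>infdist x (\<Omega> i) - infdist y (\<Omega> i)\<bar>)"
    using psi_norm_lipschitz[OF \<psi>, of "\<chi> i. infdist x (\<Omega> i)" "\<chi> i. infdist y (\<Omega> i)"]
    by (simp add: dist_objective_def infdist_nonneg)
  also have "\<dots> \<le> real CARD('n) * dist x y"
    by (intro sum_bounded_above infdist_triangle_abs)
  finally show ?thesis .
qed

text \<open>The distance to the bounded set alone grows like \<open>norm x\<close>, and the
  \<psi>-norm dominates each component.\<close>

lemma dist_objective_coercive:
  fixes \<Omega> :: "'n::finite \<Rightarrow> 'a::real_normed_vector set"
  assumes \<psi>: "\<psi> \<in> Psi_family" and i: "bounded (\<Omega> i)" "\<Omega> i \<noteq> {}"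
  obtains R where "\<And>x. norm x \<le> dist_objective \<psi> \<Omega> x + R"
proof -
  from i(1) obtain R where R: "\<And>a. a \<in> \<Omega> i \<Longrightarrow> norm a \<le> R"
    by (auto simp: bounded_iff)
  have "norm x \<le> dist_objective \<psi> \<Omega> x + R" for x
  proof -
    have "norm x - R \<le> dist x a" if "a \<in> \<Omega> i" for a
      using R[OF that] norm_triangle_ineq2[of x a] by (simp add: dist_norm)
    then have "norm x - R \<le> infdist x (\<Omega> i)"
      using i(2) unfolding infdist_notempty[OF i(2)] by (intro cINF_greatest)
    also have "\<dots> \<le> dist_objective \<psi> \<Omega> x"
      using component_le_psi_norm[OF \<psi>, of "\<chi> i. infdist x (\<Omega> i)" i]
      by (simp add: dist_objective_def infdist_nonneg)
    finally show ?thesis by simp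
  qed
  then show ?thesis by (rule that)
qed

theorem proposition3p3:
  fixes \<Omega> :: "'n::finite \<Rightarrow> 'a::banach set"
    and \<psi> :: "real ^ 'n \<Rightarrow> real"
  assumes "reflexive_space TYPE('a)"
    and "CARD('n) \<ge> 2"
    and "\<And>i. \<Omega> i \<noteq> {}"
    and "\<And>i. closed (\<Omega> i)"
    and "\<And>i. convex (\<Omega> i)"
    and "\<exists>i. bounded (\<Omega> i)"
    and "\<psi> \<in> Psi_family"
  shows "(Sol \<psi> \<Omega> \<noteq> {} \<and> closed (Sol \<psi> \<Omega>) \<and> convex (Sol \<psi> \<Omega>) \<and> bounded (Sol \<psi> \<Omega>)) \<and>
    ((\<exists>B::'a set. finite B \<and> span B = UNIV) \<longrightarrow> compact (Sol \<psi> \<Omega>))"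
proof -
  let ?f = "dist_objective \<psi> \<Omega>"
  have conv: "convex_on UNIV ?f"
    using assms by (intro dist_objective_convex) auto
  have lip: "\<bar>?f x - ?f y\<bar> \<le> real CARD('n) * norm (x - y)" for x y
    using dist_objective_lipschitz[OF assms(7), of \<Omega> x y] by (simp add: dist_norm)
  obtain R where R: "\<And>x. norm x \<le> ?f x + R"
    using dist_objective_coercive[OF assms(7)] assms(3,6) by metis
  obtain u where u: "\<And>y. ?f u \<le> ?f y"
    using reflexive_convex_attains_min[OF assms(1) conv lip R] by blast
  \<comment> \<open>As a sublevel set of \<open>?f\<close>, the solution set inherits closedness
    from continuity, convexity from convexity and boundedness from coercivity.\<close>
  have Sol: "Sol \<psi> \<Omega> = {x. ?f x \<le> ?f u}"
    using u by (auto simp: Sol_def intro: order_trans)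
  have "Sol \<psi> \<Omega> \<noteq> {}"
    by (auto simp: Sol)
  moreover have "continuous_on UNIV ?f"
    by (rule lipschitz_on_continuous_on[OF lipschitz_onI[of _ _ "real CARD('n)"]])
      (simp_all add: dist_real_def dist_objective_lipschitz[OF assms(7)])
  then have closed: "closed (Sol \<psi> \<Omega>)"
    unfolding Sol by (intro closed_Collect_le continuous_on_const)
  moreover have "convex (Sol \<psi> \<Omega>)"
    unfolding Sol
  proof (rule convexI, unfold mem_Collect_eq)
    fix x y :: 'a and a b :: real
    assume *: "?f x \<le> ?f u" "?f y \<le> ?f u" "0 \<le> a" "0 \<le> b" "a + b = 1"
    then have "?f (a *\<^sub>R x + b *\<^sub>R y) \<le> a * ?f x + b * ?f y"
      using conv by (simp add: convex_on_def)
    also have "\<dots> \<le> ?f u"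
      using * by (intro convex_bound_le)
    finally show "?f (a *\<^sub>R x + b *\<^sub>R y) \<le> ?f u" .
  qed
  moreover have "norm x \<le> ?f u + R" if "x \<in> Sol \<psi> \<Omega>" for x
    using R[of x] that by (simp add: Sol)
  then have bounded: "bounded (Sol \<psi> \<Omega>)"
    by (auto simp: bounded_iff)
  ultimately show ?thesis
    using compact_if_closed_bounded_finite_span[OF _ _ closed bounded] by blast
qed

end
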